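(* Let $n$ and $L$ be positive integers with $L\le n-1$, and let $c_{-L},c_{1-L},\ldots,c_{n-1}\in\mathbb C$ be arbitrary complex numbers apart from $c_{-L}=1$. Set $c_k=0$ for $k<-L$. Define $F(t)=\sum_{j=0}^{n+L-1}c_{j-L}t^j$ and $$d_{L-1+j}=\left.\frac{1}{(n+j)!}\,\partial_t^{\,n+j}\frac{1}{F(t)}\right|_{t=0},\qquad j=-(L-1),\ldots,L-1.$$ Then the following relation between an $n\times n$ and an $L\times L$ Toeplitz determinant holds: $$\det\left[c_{b-a}\right]_{a,b=1,\ldots,n}=(-1)^{nL}\det\left[d_{L-1+b-a}\right]_{a,b=1,\ldots,L}.$$
   Context: In both matrices $a$ is the row index and $b$ the column index. *)

theory Defs
  imports "HOL-Complex_Analysis.Complex_Analysis" "Jordan_Normal_Form.Determinant"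
begin

(* Row and column indices of the matrix type run from 0 to N - 1 rather than from 1 to N;
   the entries are unaffected, since they depend only on the difference b - a. *)
definition toeplitz_mat :: "nat \<Rightarrow> (int \<Rightarrow> complex) \<Rightarrow> complex Matrix.mat" where
  "toeplitz_mat N x = Matrix.mat N N (\<lambda>(a, b). x (int b - int a))"

end

theory Submission imports Defs begin

text \<open>
  The entries of both determinants are power series coefficients: \<open>c (b - a)\<close> is the coefficient of
  \<open>t\<close> to the power \<open>b - a + L\<close> in \<open>F\<close>, and \<open>d (L - 1 + b - a)\<close> is the coefficient of \<open>t\<close> to the power
  \<open>n + b - a\<close> in \<open>1 / F\<close>.  Upper triangular Toeplitz matrices of size \<open>n + L\<close> multiply like power
  series truncated at that order, so the Toeplitz matrices \<open>A\<close> of \<open>F\<close> and \<open>B\<close> of \<open>1 / F\<close> are inverse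
  to each other (\<open>fps_toeplitz_mat_mult\<close>), and \<open>A\<close> has determinant 1 because \<open>F 0 = 1\<close>.

  The \<open>n \<times> n\<close> determinant is the minor of \<open>A\<close> in its top right corner, and the \<open>L \<times> L\<close> determinant is
  the minor of \<open>B\<close> in its top right corner.  These minors are complementary, so Jacobi's identity for
  minors of the inverse (\<open>det_corner_of_inverse\<close>) relates them; the sign \<open>(-1) ^ (n * L)\<close> comes from
  moving a block of \<open>n\<close> columns across a block of \<open>L\<close> columns.  The truncation of \<open>F\<close> at degree
  \<open>n + L - 1\<close> is harmless because matrices of size \<open>n + L\<close> see no higher coefficients.
\<close>

text \<open>
  Take the identity matrix with its first \<open>L\<close> columns replaced by the last \<open>L\<close> columns of \<open>B\<close>.
  Multiplying by \<open>A\<close> from the left turns the columns of \<open>B\<close> into unit vectors and the remaining unit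
  vectors into columns of \<open>A\<close>.  Both this matrix and the product are block triangular, the product
  after a permutation of its columns, with the two minors as the only nontrivial diagonal blocks.
\<close>

lemma det_corner_of_inverse:
  fixes A B :: "'a :: idom mat"
  assumes A: "A \<in> carrier_mat (n + L) (n + L)" and B: "B \<in> carrier_mat (n + L) (n + L)"
    and AB: "A * B = 1\<^sub>m (n + L)"
  shows "det (mat n n (\<lambda>(i, j). A $$ (i, j + L))) =
    (-1) ^ (n * L) * det A * det (mat L L (\<lambda>(i, j). B $$ (i, j + n)))"
proof -
  let ?N = "n + L"
  define C where "C = mat n n (\<lambda>(i, j). A $$ (i, j + L))"
  define G where "G = mat L L (\<lambda>(i, j). B $$ (i, j + n))"
  define X where "X = mat ?N ?N (\<lambda>(i, j). if j < L then B $$ (i, j + n) else if i = j then 1 else 0)"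
  define Y where "Y = mat ?N ?N (\<lambda>(i, j). if j < L then if i = j + n then 1 else 0 else A $$ (i, j))"
  have X: "X \<in> carrier_mat ?N ?N" and Y: "Y \<in> carrier_mat ?N ?N"
    by (simp_all add: X_def Y_def)
  have "X = four_block_mat G (0\<^sub>m L n) (mat n L (\<lambda>(i, j). B $$ (i + L, j + n))) (1\<^sub>m n)"
    by (rule eq_matI) (auto simp: X_def G_def)
  then have det_X: "det X = det G"
    by (simp add: det_four_block_mat_upper_right_zero[of _ L _ n] G_def)
  have "A * X = Y"
  proof (rule eq_matI)
    fix i j assume "i < dim_row Y" "j < dim_col Y"
    then have ij: "i < ?N" "j < ?N" by (auto simp: Y_def)
    show "(A * X) $$ (i, j) = Y $$ (i, j)"
    proof (cases "j < L")
      case True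
      then have "col X j = col B (j + n)"
        using ij B by (intro eq_vecI) (auto simp: X_def)
      then have "(A * X) $$ (i, j) = (A * B) $$ (i, j + n)"
        using ij True A B X by simp
      then show ?thesis
        using ij True by (simp add: AB Y_def)
    next
      case False
      then have "col X j = unit_vec ?N j"
        using ij by (intro eq_vecI) (auto simp: X_def)
      then show ?thesis
        using ij False A X by (simp add: Y_def)
    qed
  qed (use A X in \<open>auto simp: Y_def\<close>)
  then have "det A * det G = det Y"
    using det_mult[OF A X] det_X by simp
  also have "det Y = (-1) ^ (n * L) *
      det (mat ?N ?N (\<lambda>(i, j). Y $$ (i, if j < n then j + L else j - n)))"
    by (rule det_swap_cols[OF Y])
  also have "mat ?N ?N (\<lambda>(i, j). Y $$ (i, if j < n then j + L else j - n)) =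
      four_block_mat C (0\<^sub>m n L) (mat L n (\<lambda>(i, j). A $$ (i + n, j + L))) (1\<^sub>m L)"
    by (rule eq_matI) (auto simp: Y_def C_def)
  also have "det \<dots> = det C"
    by (simp add: det_four_block_mat_upper_right_zero[of _ n _ L] C_def)
  finally have "(-1) ^ (n * L) * det A * det G = ((-1) * (-1)) ^ (n * L) * det C"
    by (simp only: power_mult_distrib mult.assoc)
  then show ?thesis
    by (simp add: C_def G_def)
qed

definition fps_toeplitz_mat :: "nat \<Rightarrow> 'a :: comm_ring_1 fps \<Rightarrow> 'a mat" where
  "fps_toeplitz_mat N f = mat N N (\<lambda>(i, j). if i \<le> j then fps_nth f (j - i) else 0)"

lemma fps_toeplitz_mat_carrier: "fps_toeplitz_mat N f \<in> carrier_mat N N"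
  by (simp add: fps_toeplitz_mat_def)

lemma fps_toeplitz_mat_1: "fps_toeplitz_mat N 1 = 1\<^sub>m N"
  by (rule eq_matI) (auto simp: fps_toeplitz_mat_def)

lemma fps_toeplitz_mat_mult:
  "fps_toeplitz_mat N f * fps_toeplitz_mat N g = fps_toeplitz_mat N (f * g)"
proof (rule eq_matI)
  fix i j assume "i < dim_row (fps_toeplitz_mat N (f * g))" "j < dim_col (fps_toeplitz_mat N (f * g))"
  then have ij: "i < N" "j < N"
    by (auto simp: fps_toeplitz_mat_def)
  have "(fps_toeplitz_mat N f * fps_toeplitz_mat N g) $$ (i, j) =
      (\<Sum>k = 0..<N. (if i \<le> k then fps_nth f (k - i) else 0) * (if k \<le> j then fps_nth g (j - k) else 0))"
    using ij by (simp add: fps_toeplitz_mat_def scalar_prod_def)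
  also have "\<dots> = (\<Sum>k = i..j. fps_nth f (k - i) * fps_nth g (j - k))"
    using ij by (intro sum.mono_neutral_cong_right) auto
  also have "\<dots> = (if i \<le> j then fps_nth (f * g) (j - i) else 0)"
  proof (cases "i \<le> j")
    case True
    then show ?thesis
      unfolding fps_mult_nth
      by (auto intro!: sum.reindex_bij_witness[of _ "\<lambda>k. k + i" "\<lambda>k. k - i"] simp: diff_diff_left)
  qed simp
  finally show "(fps_toeplitz_mat N f * fps_toeplitz_mat N g) $$ (i, j) = fps_toeplitz_mat N (f * g) $$ (i, j)"
    using ij by (simp add: fps_toeplitz_mat_def)
qed (auto simp: fps_toeplitz_mat_def)

lemma det_fps_toeplitz_mat: "det (fps_toeplitz_mat N f) = fps_nth f 0 ^ N"
proof -
  have "upper_triangular (fps_toeplitz_mat N f)"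
    by (auto simp: fps_toeplitz_mat_def)
  moreover have "diag_mat (fps_toeplitz_mat N f) = replicate N (fps_nth f 0)"
    by (rule nth_equalityI) (auto simp: diag_mat_def fps_toeplitz_mat_def)
  ultimately show ?thesis
    by (simp add: det_upper_triangular[OF _ fps_toeplitz_mat_carrier])
qed

theorem mainTheorem7:
  fixes n L :: nat
    and c d :: "int \<Rightarrow> complex"
    and F :: "complex \<Rightarrow> complex"
  assumes "n \<ge> 1" and "L \<ge> 1" and "L \<le> n - 1"
    and "c (- int L) = 1"
    and "\<And>k. k < - int L \<Longrightarrow> c k = 0"
    and "\<And>t. F t = (\<Sum>j = 0..n + L - 1. c (int j - int L) * t ^ j)"
    and "\<And>j. j \<in> {- (int L - 1)..int L - 1} \<Longrightarrow>
           d (int L - 1 + j) =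
             1 / fact (nat (int n + j)) * (deriv ^^ nat (int n + j)) (\<lambda>t. 1 / F t) 0"
  shows "Determinant.det (toeplitz_mat n c) =
           (-1) ^ (n * L) * Determinant.det (toeplitz_mat L (\<lambda>k. d (int L - 1 + k)))"
proof -
  define f :: "complex fps" where
    "f = (\<Sum>j = 0..n + L - 1. fps_const (c (int j - int L)) * fps_X ^ j)"
  have f_nth: "fps_nth f m = c (int m - int L)" if "m < n + L" for m
    using that by (auto simp: f_def fps_sum_nth fps_X_power_nth if_distrib sum.delta cong: if_cong)
  have f_0: "fps_nth f 0 = 1"
    using f_nth[of 0] assms(1,4) by simp
  have "F has_fps_expansion f"
    unfolding assms(6) [abs_def] f_def by (intro fps_expansion_intros)
  then have "(\<lambda>t. 1 / F t) has_fps_expansion inverse f"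
    using has_fps_expansion_inverse[of F f] f_0 by (simp add: inverse_eq_divide)
  then have inv_nth: "fps_nth (inverse f) m = 1 / fact m * (deriv ^^ m) (\<lambda>t. 1 / F t) 0" for m
    by (simp add: fps_nth_fps_expansion)

  let ?A = "fps_toeplitz_mat (n + L) f" and ?B = "fps_toeplitz_mat (n + L) (inverse f)"
  have "toeplitz_mat n c = mat n n (\<lambda>(i, j). ?A $$ (i, j + L))"
    by (rule eq_matI) (auto simp: toeplitz_mat_def fps_toeplitz_mat_def f_nth of_nat_diff
        algebra_simps intro: assms(5))
  moreover have "toeplitz_mat L (\<lambda>k. d (int L - 1 + k)) = mat L L (\<lambda>(i, j). ?B $$ (i, j + n))"
  proof (rule eq_matI)
    fix i j assume "i < dim_row (mat L L (\<lambda>(i, j). ?B $$ (i, j + n)))"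
      "j < dim_col (mat L L (\<lambda>(i, j). ?B $$ (i, j + n)))"
    then have ij: "i < L" "j < L" by auto
    \<comment> \<open>Since \<open>L \<le> n\<close>, the lower left zeros of \<open>?B\<close> stay outside this corner.\<close>
    then have "i \<le> j + n" using assms(3) by simp
    then have "nat (int n + (int j - int i)) = j + n - i" by simp
    then have "d (int L - 1 + (int j - int i)) = fps_nth (inverse f) (j + n - i)"
      using ij assms(7)[of "int j - int i"] by (simp add: inv_nth)
    then show "toeplitz_mat L (\<lambda>k. d (int L - 1 + k)) $$ (i, j) = mat L L (\<lambda>(i, j). ?B $$ (i, j + n)) $$ (i, j)"
      using ij \<open>i \<le> j + n\<close> by (simp add: toeplitz_mat_def fps_toeplitz_mat_def)
  qed (auto simp: toeplitz_mat_def)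
  moreover have "?A * ?B = 1\<^sub>m (n + L)"
    using f_0 by (simp add: fps_toeplitz_mat_mult fps_toeplitz_mat_1 mult.commute[of f] inverse_mult_eq_1)
  ultimately show ?thesis
    using det_corner_of_inverse[OF fps_toeplitz_mat_carrier fps_toeplitz_mat_carrier, of n L f "inverse f"]
    by (simp add: det_fps_toeplitz_mat f_0)
qed

end
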